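(* Let $G$ be any finite undirected graph on $n$ vertices. Then the numbers $\widetilde d_k(G)$ form a log-concave sequence, i.e. \[ \widetilde d_k(G)^2\ge \widetilde d_{k-1}(G)\,\widetilde d_{k+1}(G)\qquad\text{for } k=1,\ldots,n-1 . \]
   Context: Let $G=(V,E)$ be an undirected graph with $V=\{1,\ldots,n\}$ and adjacency matrix $A$ (so $A_{i,j}=1$ if $\{i,j\}\in E$ and $A_{i,j}=0$ otherwise). Define the polytope \[ P(G)=\{\mathbf{x}\in[0,1]^n : (A\mathbf{x})_i+x_i\ge 1,\ i=1,\ldots,n\}, \] i.e. the set of $\mathbf x\in[0,1]^n$ with $x_i+\sum_{j:\{i,j\}\in E}x_j\ge 1$ for every $i$. For any real $k\in[0,n]$ put \[ D_k(G)=\Big\{x\in P(G): \sum_{v\in V}x_v=k\Big\},\qquad \widetilde d_k(G)=\mathrm{Vol}_{n-1}(D_k(G)), \] where $\mathrm{Vol}_{n-1}$ denotes $(n-1)$-dimensional Lebesgue measure (on the hyperplane $\{x\in\mathbb R^n:\sum_v x_v=k\}$). *)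

theory Defs
  imports "HOL-Analysis.Analysis"
begin

text \<open>A graph is given by its edge set \<open>E\<close>; the vertex set is the whole type \<open>'n\<close>, so
  \<open>n = CARD('n)\<close>.  Taking \<open>i = j\<close> below is allowed: loops are not excluded, and a loop at
  \<open>i\<close> makes the corresponding diagonal entry of the adjacency matrix equal to 1.\<close>

definition undirected_graph :: "'n set set \<Rightarrow> bool" where
  "undirected_graph E \<longleftrightarrow> (\<forall>e\<in>E. \<exists>i j. e = {i, j})"

definition adjacency_matrix :: "'n::finite set set \<Rightarrow> real^'n^'n" where
  "adjacency_matrix E = (\<chi> i j. if {i, j} \<in> E then 1 else 0)"

definition graph_polytope :: "'n::finite set set \<Rightarrow> (real^'n) set" where
  "graph_polytope E =
     {x. (\<forall>i. x $ i \<in> {0..1}) \<and> (\<forall>i. (adjacency_matrix E *v x) $ i + x $ i \<ge> 1)}"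

definition sum_hyperplane :: "real \<Rightarrow> (real^'n::finite) set" where
  "sum_hyperplane k = {x. (\<Sum>v\<in>UNIV. x $ v) = k}"

definition graph_slice :: "'n::finite set set \<Rightarrow> real \<Rightarrow> (real^'n) set" where
  "graph_slice E k = graph_polytope E \<inter> sum_hyperplane k"

definition orthonormal_frame :: "(nat \<Rightarrow> 'a::euclidean_space) \<Rightarrow> nat \<Rightarrow> 'a set \<Rightarrow> bool" where
  "orthonormal_frame b m U \<longleftrightarrow>
     (\<forall>i<m. \<forall>j<m. b i \<bullet> b j = (if i = j then 1 else 0)) \<and> span (b ` {..<m}) = U"

text \<open>The \<open>m\<close>-dimensional Lebesgue measure on an \<open>m\<close>-dimensional nonempty affine subspace \<open>H\<close>,
  viewed as a measure on the ambient space concentrated on \<open>H\<close>: the image of Lebesgue measure on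
  \<open>\<real>\<^sup>m\<close> under an isometric parametrization \<open>y \<mapsto> p + (\<Sum>i<m. y i *\<^sub>R b i)\<close> of \<open>H\<close>.  Since
  Lebesgue measure is invariant under isometries, the choice of the base point \<open>p\<close> and of the
  orthonormal basis \<open>b\<close> of the direction space is immaterial.\<close>

definition affine_lebesgue :: "'a::euclidean_space set \<Rightarrow> 'a measure" where
  "affine_lebesgue H =
     (let m = nat (aff_dim H);
          p = (SOME p. p \<in> H);
          b = (SOME b. orthonormal_frame b m ((\<lambda>x. x - p) ` H))
      in completion (distr (PiM {..<m} (\<lambda>_. lborel)) borel (\<lambda>y. p + (\<Sum>i<m. y i *\<^sub>R b i))))"

text \<open>Slices are compact, so taking the real-valued \<open>measure\<close> does not lose an infinite volume.\<close>

definition slice_volume :: "'n::finite set set \<Rightarrow> real \<Rightarrow> real" where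
  "slice_volume E k = measure (affine_lebesgue (sum_hyperplane k)) (graph_slice E k)"

end

theory Submission
  imports Defs
begin

text \<open>The polytope \<open>P\<close> is convex, so the midpoint of a point of \<open>P\<close> with coordinate sum \<open>k - 1\<close> and one
  with coordinate sum \<open>k + 1\<close> is a point of \<open>P\<close> with coordinate sum \<open>k\<close>. The middle slice thus contains
  half of the Minkowski sum of its two neighbours, and the multiplicative form of the
  Brunn-Minkowski inequality, \<open>vol S * vol T \<le> (vol R)\<^sup>2\<close> if \<open>R\<close> contains all midpoints of points of \<open>S\<close>
  and \<open>T\<close>, is the claim (\<open>brunn_minkowski_parallel\<close>). Apart from convexity, the polytope enters through
  closedness, which makes its slices measurable, and boundedness, which makes their volumes finite.

  The Brunn-Minkowski inequality is obtained from its functional version, the Prekopa-Leindler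
  inequality \<open>\<integral>f * \<integral>g \<le> (\<integral>h)\<^sup>2\<close> for \<open>f x * g y \<le> (h ((x + y) / 2 + c))\<^sup>2\<close>, because, unlike
  Brunn-Minkowski itself, this version can be integrated out one coordinate at a time
  (\<open>prekopa_leindler_PiM\<close>). So the geometry reduces to the line. There the integrals are written as
  integrals of the lengths of superlevel sets, and these are compared by the one-dimensional
  Brunn-Minkowski inequality (\<open>brunn_minkowski_real\<close>): a sumset of two sets of reals contains a
  translate of each, and the two translates can be placed next to each other.

  The three slices lie in parallel hyperplanes. These can be parametrized by \<open>\<real>\<^sup>m\<close> with one orthonormal
  basis, but with unrelated base points (\<open>affine_lebesgue_sum_hyperplane\<close>); the shift \<open>c\<close> in the
  inequalities accounts for the latter.\<close>

section \<open>The Brunn-Minkowski inequality on the line\<close>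

lemma emeasure_lborel_affine_vimage:
  fixes A :: "real set"
  assumes [measurable]: "A \<in> sets borel" and "s \<noteq> 0"
  shows "emeasure lborel A = ennreal \<bar>s\<bar> * emeasure lborel {x. t + s * x \<in> A}"
proof -
  have "emeasure lborel A = (\<integral>\<^sup>+x. indicator A x \<partial>lborel)"
    by simp
  also have "\<dots> = ennreal \<bar>s\<bar> * (\<integral>\<^sup>+x. indicator A (t + s * x) \<partial>lborel)"
    using assms by (intro nn_integral_real_affine) auto
  also have "(\<integral>\<^sup>+x. indicator A (t + s * x) \<partial>lborel) =
      (\<integral>\<^sup>+x. indicator {x. t + s * x \<in> A} x \<partial>lborel)"
    by (intro nn_integral_cong) (auto split: split_indicator)
  also have "\<dots> = emeasure lborel {x. t + s * x \<in> A}"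
    by (intro nn_integral_indicator) measurable
  finally show ?thesis .
qed

text \<open>Points of \<open>A\<close> approach \<open>Sup A\<close> (or \<open>\<infinity>\<close>), so the sets \<open>A \<inter> {..<k}\<close> with \<open>k \<in> A\<close> exhaust
  \<open>A\<close> except possibly for the null set \<open>{Sup A}\<close>. Cutting at points of \<open>A\<close> in this way replaces the
  usual passage to compact subsets, whose purpose is to have an extreme point in \<open>A\<close>. The
  summand \<open>d\<close> stays on the left because a bound by the difference \<open>m - d\<close> would say nothing when
  both are infinite.\<close>

lemma emeasure_le_if_lower_cuts_le:
  fixes A :: "real set"
  assumes [measurable]: "A \<in> sets borel" and ne: "A \<noteq> {}"
    and cuts: "\<And>k. k \<in> A \<Longrightarrow> emeasure lborel (A \<inter> {..<k}) + d \<le> m"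
  shows "emeasure lborel A + d \<le> m"
proof -
  obtain q :: "nat \<Rightarrow> real" and S where inc: "incseq q" and S: "S = (\<Union>n. A \<inter> {..<q n})"
    and A: "A \<subseteq> S \<union> {Sup A}" and above: "\<And>n. \<exists>k\<in>A. q n < k"
  proof (cases "bdd_above A")
    case False
    have "\<exists>k\<in>A. real n < k" for n
      using False by (meson bdd_above.I not_le)
    moreover have "A \<subseteq> (\<Union>n. A \<inter> {..<real n})"
      using reals_Archimedean2 by auto
    moreover have "incseq (\<lambda>n. real n)"
      by (simp add: incseq_def)
    ultimately show ?thesis
      using that[of real] by blast
  next
    case True
    define q where "q n = Sup A - 1 / real (Suc n)" for n
    have "\<exists>k\<in>A. q n < k" for n
      using less_cSup_iff[OF ne True, of "q n"] by (simp add: q_def)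
    moreover have "A \<subseteq> (\<Union>n. A \<inter> {..<q n}) \<union> {Sup A}"
    proof
      fix x assume x: "x \<in> A"
      show "x \<in> (\<Union>n. A \<inter> {..<q n}) \<union> {Sup A}"
      proof (cases "x = Sup A")
        case False
        then have "0 < Sup A - x"
          using cSup_upper[OF x True] by simp
        then obtain n where "1 / real (Suc n) < Sup A - x"
          using nat_approx_posE by blast
        then have "x < q n"
          by (simp add: q_def)
        with x show ?thesis by auto
      qed auto
    qed
    moreover have "incseq q"
      by (auto simp: incseq_def q_def intro!: diff_left_mono divide_left_mono)
    ultimately show ?thesis
      using that[of q] by blast
  qed
  have "emeasure lborel A \<le> emeasure lborel (S \<union> {Sup A})"
    by (intro emeasure_mono A) (simp add: S)
  also have "\<dots> = emeasure lborel S"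
    by (intro emeasure_Un_null_set) (auto simp: S)
  also have "\<dots> = (SUP n. emeasure lborel (A \<inter> {..<q n}))"
    unfolding S
  proof (rule SUP_emeasure_incseq[symmetric])
    show "incseq (\<lambda>n. A \<inter> {..<q n})"
      using inc by (fastforce simp: incseq_def)
  qed auto
  finally have "emeasure lborel A + d \<le> (SUP n. emeasure lborel (A \<inter> {..<q n})) + d"
    by (rule add_right_mono)
  also have "\<dots> = (SUP n. emeasure lborel (A \<inter> {..<q n}) + d)"
    by (rule ennreal_SUP_add_left[symmetric]) simp
  also have "\<dots> \<le> m"
  proof (rule SUP_least)
    fix n
    obtain k where k: "k \<in> A" "q n < k"
      using above by blast
    have "emeasure lborel (A \<inter> {..<q n}) + d \<le> emeasure lborel (A \<inter> {..<k}) + d"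
      using k by (intro add_right_mono emeasure_mono) auto
    also have "\<dots> \<le> m"
      using cuts k by blast
    finally show "emeasure lborel (A \<inter> {..<q n}) + d \<le> m" .
  qed
  finally show ?thesis .
qed

lemma emeasure_le_if_upper_cuts_le:
  fixes A :: "real set"
  assumes [measurable]: "A \<in> sets borel" and ne: "A \<noteq> {}"
    and cuts: "\<And>k. k \<in> A \<Longrightarrow> emeasure lborel (A \<inter> {k<..}) + d \<le> m"
  shows "emeasure lborel A + d \<le> m"
proof -
  let ?A = "{x. 0 + (-1) * x \<in> A}"
  have "emeasure lborel ?A + d \<le> m"
  proof (rule emeasure_le_if_lower_cuts_le)
    obtain a where "a \<in> A"
      using ne by blast
    then have "-a \<in> ?A" by simp
    then show "?A \<noteq> {}" by blast
    fix k assume "k \<in> ?A"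
    moreover have "?A \<inter> {..<k} = {x. 0 + (-1) * x \<in> A \<inter> {-k<..}}"
      by auto
    ultimately show "emeasure lborel (?A \<inter> {..<k}) + d \<le> m"
      using cuts[of "-k"] emeasure_lborel_affine_vimage[of "A \<inter> {-k<..}" "-1" 0] by simp
  qed measurable
  then show ?thesis
    using emeasure_lborel_affine_vimage[of A "-1" 0] by simp
qed

text \<open>For \<open>k \<in> A\<close> and \<open>l \<in> B\<close>, the translate of \<open>A \<inter> {..<k}\<close> by \<open>l\<close> lies below \<open>k + l\<close>, the
  translate of \<open>B \<inter> {l<..}\<close> by \<open>k\<close> lies above it, and both lie in the sumset. They are disjoint, so
  their measures add up to at most that of the sumset; the supremum over \<open>k\<close> and \<open>l\<close> gives the claim.\<close>

lemma brunn_minkowski_real: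
  fixes A B C :: "real set"
  assumes [measurable]: "A \<in> sets borel" "B \<in> sets borel" "C \<in> sets borel"
    and ne: "A \<noteq> {}" "B \<noteq> {}"
    and mid: "\<And>u v. u \<in> A \<Longrightarrow> v \<in> B \<Longrightarrow> (u + v) / 2 + c \<in> C"
  shows "emeasure lborel A + emeasure lborel B \<le> 2 * emeasure lborel C"
proof -
  \<comment> \<open>The preimage of \<open>C\<close> that contains the sumset of \<open>A\<close> and \<open>B\<close>.\<close>
  define D where "D = {z. c + (1/2) * z \<in> C}"
  have [measurable]: "D \<in> sets borel"
    unfolding D_def by measurable
  have "emeasure lborel C = ennreal (1/2) * emeasure lborel D"
    using emeasure_lborel_affine_vimage[of C "1/2" c] by (simp add: D_def)
  then have "2 * emeasure lborel C = (ennreal 2 * ennreal (1/2)) * emeasure lborel D"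
    by (simp add: mult.assoc)
  also have "ennreal 2 * ennreal (1/2) = 1"
    by (subst ennreal_mult[symmetric]) auto
  finally have D: "2 * emeasure lborel C = emeasure lborel D"
    by simp
  have key: "emeasure lborel (A \<inter> {..<k}) + emeasure lborel (B \<inter> {l<..}) \<le> emeasure lborel D"
    if "k \<in> A" "l \<in> B" for k l
  proof -
    let ?A = "{z. -l + 1 * z \<in> A \<inter> {..<k}}" and ?B = "{z. -k + 1 * z \<in> B \<inter> {l<..}}"
    have "emeasure lborel (A \<inter> {..<k}) = emeasure lborel ?A"
         "emeasure lborel (B \<inter> {l<..}) = emeasure lborel ?B"
      using emeasure_lborel_affine_vimage[of "A \<inter> {..<k}" 1 "-l"]
        emeasure_lborel_affine_vimage[of "B \<inter> {l<..}" 1 "-k"] by simp_all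
    moreover have "emeasure lborel ?A + emeasure lborel ?B = emeasure lborel (?A \<union> ?B)"
    proof (rule plus_emeasure)
      show "?A \<in> sets lborel" "?B \<in> sets lborel" by simp_all
    qed auto
    moreover have "emeasure lborel (?A \<union> ?B) \<le> emeasure lborel D"
    proof (rule emeasure_mono)
      show "?A \<union> ?B \<subseteq> D"
      proof
        fix z assume "z \<in> ?A \<union> ?B"
        then show "z \<in> D"
          using mid[of "z - l" l] mid[of k "z - k"] that by (auto simp: D_def add.commute)
      qed
    qed simp
    ultimately show ?thesis by simp
  qed
  have lower: "emeasure lborel A + emeasure lborel (B \<inter> {l<..}) \<le> emeasure lborel D"
    if l: "l \<in> B" for l
    by (rule emeasure_le_if_lower_cuts_le[OF _ ne(1) key[OF _ l]]) simp
  have "emeasure lborel B + emeasure lborel A \<le> emeasure lborel D"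
  proof (rule emeasure_le_if_upper_cuts_le[OF _ ne(2)])
    fix l assume "l \<in> B"
    from lower[OF this]
    show "emeasure lborel (B \<inter> {l<..}) + emeasure lborel A \<le> emeasure lborel D"
      by (simp only: add.commute)
  qed simp
  then show ?thesis
    unfolding D by (simp only: add.commute)
qed

section \<open>The Prekopa-Leindler inequality on the line\<close>

text \<open>Both sides are the product measure of the region \<open>0 < t < F x\<close> under the graph of \<open>F\<close>.\<close>

lemma nn_integral_layer_cake:
  fixes F :: "'a \<Rightarrow> real"
  assumes "sigma_finite_measure M" and [measurable]: "F \<in> borel_measurable M"
  shows "(\<integral>\<^sup>+x. ennreal (F x) \<partial>M) =
    (\<integral>\<^sup>+t. indicator {0<..} t * emeasure M {x \<in> space M. t < F x} \<partial>lborel)"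
proof -
  interpret sigma_finite_measure M by fact
  interpret pair_sigma_finite M lborel by unfold_locales
  have "(\<integral>\<^sup>+x. ennreal (F x) \<partial>M) = (\<integral>\<^sup>+x. (\<integral>\<^sup>+t. indicator {t. 0 < t \<and> t < F x} t \<partial>lborel) \<partial>M)"
  proof (rule nn_integral_cong)
    fix x
    have "{t. 0 < t \<and> t < F x} = {0<..<F x}" by auto
    then show "ennreal (F x) = (\<integral>\<^sup>+t. indicator {t. 0 < t \<and> t < F x} t \<partial>lborel)"
      by (cases "0 \<le> F x") (auto simp: ennreal_neg)
  qed
  also have "\<dots> = (\<integral>\<^sup>+x. (\<integral>\<^sup>+t. (if 0 < t \<and> t < F x then 1 else 0) \<partial>lborel) \<partial>M)"
    by (intro nn_integral_cong) (auto split: split_indicator)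
  also have "\<dots> = (\<integral>\<^sup>+t. (\<integral>\<^sup>+x. (if 0 < t \<and> t < F x then 1 else 0) \<partial>M) \<partial>lborel)"
    by (rule Fubini'[symmetric]) measurable
  also have "\<dots> = (\<integral>\<^sup>+t. indicator {0<..} t * emeasure M {x \<in> space M. t < F x} \<partial>lborel)"
  proof (rule nn_integral_cong)
    fix t :: real
    have "(\<integral>\<^sup>+x. (if 0 < t \<and> t < F x then 1 else 0) \<partial>M) =
      (\<integral>\<^sup>+x. indicator {0<..} t * indicator {x \<in> space M. t < F x} x \<partial>M)"
      by (intro nn_integral_cong) (auto split: split_indicator)
    also have "\<dots> = indicator {0<..} t * emeasure M {x \<in> space M. t < F x}"
      by (subst nn_integral_cmult) auto
    finally show "(\<integral>\<^sup>+x. (if 0 < t \<and> t < F x then 1 else 0) \<partial>M) = \<dots>" .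
  qed
  finally show ?thesis .
qed

text \<open>The inequality between geometric and arithmetic mean, in the form that converts additive
  Brunn-Minkowski estimates into multiplicative ones.\<close>

lemma ennreal_mult_le_square_if_sum_le:
  fixes a b c :: ennreal
  assumes "a + b \<le> 2 * c"
  shows "a * b \<le> c\<^sup>2"
proof (cases "c = top")
  case True
  then show ?thesis by (simp add: power2_eq_square)
next
  case False
  then have "2 * c < top"
    by (simp add: ennreal_mult_less_top less_top)
  with assms have "a + b < top"
    by (rule le_less_trans)
  then have "a < top" "b < top"
    by auto
  then obtain x y z where xyz: "0 \<le> x" "0 \<le> y" "0 \<le> z" "a = ennreal x" "b = ennreal y" "c = ennreal z"
    using False by (metis ennreal_cases less_irrefl)
  have "ennreal (x + y) \<le> ennreal (2 * z)"
    using assms xyz by (simp add: ennreal_mult)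
  then have "x + y \<le> 2 * z"
    by (subst (asm) ennreal_le_iff) (use xyz in auto)
  then have "(x + y)\<^sup>2 \<le> (2 * z)\<^sup>2"
    using xyz by (intro power_mono) auto
  moreover have "4 * (x * y) \<le> (x + y)\<^sup>2"
    using zero_le_power2[of "x - y"] by (simp add: power2_eq_square algebra_simps)
  ultimately have "x * y \<le> z\<^sup>2"
    by (simp add: power_mult_distrib)
  then show ?thesis
    using xyz by (simp add: ennreal_mult[symmetric] ennreal_power)
qed

text \<open>The hypothesis puts \<open>(u + v) / 2 + c\<close> into the superlevel set \<open>H > t\<close> whenever \<open>u\<close> and \<open>v\<close> lie in
  the superlevel sets of \<open>F\<close> and \<open>G\<close> for the same \<open>t > 0\<close>, so Brunn-Minkowski compares the three
  superlevel sets, and integration over \<open>t\<close> compares the integrals. As both functions have supremum 1,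
  the superlevel sets of \<open>F\<close> and \<open>G\<close> are nonempty for the same levels; without this,
  Brunn-Minkowski could not be applied at the levels where just one of them is empty.\<close>

lemma prekopa_leindler_normalized:
  fixes F G H :: "real \<Rightarrow> real"
  assumes [measurable]: "F \<in> borel_measurable borel" "G \<in> borel_measurable borel"
      "H \<in> borel_measurable borel"
    and F: "\<And>x. F x \<le> 1" "\<And>t. t < 1 \<Longrightarrow> \<exists>x. t < F x"
    and G: "\<And>x. G x \<le> 1" "\<And>t. t < 1 \<Longrightarrow> \<exists>x. t < G x"
    and H: "\<And>x. 0 \<le> H x"
    and mid: "\<And>u v. F u * G v \<le> (H ((u + v) / 2 + c))\<^sup>2"
  shows "(\<integral>\<^sup>+x. F x \<partial>lborel) + (\<integral>\<^sup>+x. G x \<partial>lborel) \<le> 2 * (\<integral>\<^sup>+x. H x \<partial>lborel)"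
proof -
  \<comment> \<open>The integrand of the layer cake formula for \<open>K\<close>.\<close>
  define \<phi> where "\<phi> K t = (indicator {0<..} t * emeasure lborel {x. t < K x} :: ennreal)"
    for K :: "real \<Rightarrow> real" and t :: real
  have layer: "(\<integral>\<^sup>+x. K x \<partial>lborel) = (\<integral>\<^sup>+t. \<phi> K t \<partial>lborel)"
    if "K \<in> borel_measurable borel" for K :: "real \<Rightarrow> real"
    using nn_integral_layer_cake[of lborel K] that
    by (simp add: \<phi>_def lborel.sigma_finite_measure_axioms)
  have [measurable]: "\<phi> K \<in> borel_measurable borel" if [measurable]: "K \<in> borel_measurable borel" for K
    unfolding \<phi>_def by measurable
  have "\<phi> F t + \<phi> G t \<le> 2 * \<phi> H t" for t
  proof (cases "0 < t \<and> t < 1")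
    case True
    have "emeasure lborel {x. t < F x} + emeasure lborel {x. t < G x} \<le> 2 * emeasure lborel {x. t < H x}"
    proof (rule brunn_minkowski_real[where c = c])
      fix u v assume "u \<in> {x. t < F x}" "v \<in> {x. t < G x}"
      then have "t\<^sup>2 < F u * G v"
        using True by (simp add: power2_eq_square mult_strict_mono)
      also have "\<dots> \<le> (H ((u + v) / 2 + c))\<^sup>2"
        by (rule mid)
      finally show "(u + v) / 2 + c \<in> {x. t < H x}"
        using H power2_less_imp_less by blast
    qed (use F(2)[of t] G(2)[of t] True in auto)
    then show ?thesis
      using True by (simp add: \<phi>_def)
  next
    case False
    then have "0 < t \<Longrightarrow> {x. t < F x} = {} \<and> {x. t < G x} = {}"
      using F(1) G(1) by (auto simp: not_less intro: order_trans)
    then show ?thesis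
      by (auto simp: \<phi>_def indicator_def)
  qed
  then have "(\<integral>\<^sup>+t. \<phi> F t + \<phi> G t \<partial>lborel) \<le> (\<integral>\<^sup>+t. 2 * \<phi> H t \<partial>lborel)"
    by (intro nn_integral_mono) auto
  then show ?thesis
    by (simp add: layer nn_integral_add nn_integral_cmult)
qed

text \<open>Hypothesis and conclusion do not change when \<open>F\<close>, \<open>G\<close> and \<open>H\<close> are divided by \<open>a\<close>, \<open>b\<close> and
  \<open>sqrt (a * b)\<close>; with the suprema of \<open>F\<close> and \<open>G\<close> for \<open>a\<close> and \<open>b\<close> this gives the normalized case.\<close>

lemma prekopa_leindler_bounded:
  fixes F G H :: "real \<Rightarrow> real"
  assumes [measurable]: "F \<in> borel_measurable borel" "G \<in> borel_measurable borel"
      "H \<in> borel_measurable borel"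
    and F: "\<And>x. 0 \<le> F x" "bdd_above (range F)"
    and G: "\<And>x. 0 \<le> G x" "bdd_above (range G)"
    and H: "\<And>x. 0 \<le> H x"
    and mid: "\<And>u v. F u * G v \<le> (H ((u + v) / 2 + c))\<^sup>2"
  shows "(\<integral>\<^sup>+x. F x \<partial>lborel) * (\<integral>\<^sup>+x. G x \<partial>lborel) \<le> (\<integral>\<^sup>+x. H x \<partial>lborel)\<^sup>2"
proof -
  define a b where "a = (SUP x. F x)" and "b = (SUP x. G x)"
  have Fa: "F x \<le> a" and Gb: "G x \<le> b" for x
    unfolding a_def b_def using F G by (auto intro: cSUP_upper)
  show ?thesis
  proof (cases "a \<le> 0 \<or> b \<le> 0")
    case True
    then have "(\<forall>x. F x = 0) \<or> (\<forall>x. G x = 0)"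
      using F(1) G(1) Fa Gb by (meson order.antisym order_trans)
    then show ?thesis by auto
  next
    case False
    then have pos: "0 < a" "0 < b" by auto
    define s where "s = sqrt (a * b)"
    have s: "0 < s" "s\<^sup>2 = a * b"
      using pos by (auto simp: s_def)
    have scale: "(\<integral>\<^sup>+x. K x \<partial>lborel) = ennreal r * (\<integral>\<^sup>+x. K x / r \<partial>lborel)"
      if "0 < r" and [measurable]: "K \<in> borel_measurable borel" for r and K :: "real \<Rightarrow> real"
    proof -
      have "(\<integral>\<^sup>+x. K x \<partial>lborel) = (\<integral>\<^sup>+x. ennreal r * ennreal (K x / r) \<partial>lborel)"
        using that by (intro nn_integral_cong) (simp add: ennreal_mult'[symmetric])
      also have "\<dots> = ennreal r * (\<integral>\<^sup>+x. K x / r \<partial>lborel)"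
        by (intro nn_integral_cmult) simp
      finally show ?thesis .
    qed
    have "(\<integral>\<^sup>+x. F x / a \<partial>lborel) + (\<integral>\<^sup>+x. G x / b \<partial>lborel) \<le> 2 * (\<integral>\<^sup>+x. H x / s \<partial>lborel)"
    proof (rule prekopa_leindler_normalized[where c = c])
      show "F x / a \<le> 1" "G x / b \<le> 1" "0 \<le> H x / s" for x
        using pos s Fa Gb H by (auto simp: divide_le_eq)
      show "\<exists>x. t < F x / a" if "t < 1" for t
        using that pos less_cSUP_iff[of UNIV F "t * a"] F(2)
        by (auto simp: less_divide_eq a_def)
      show "\<exists>x. t < G x / b" if "t < 1" for t
        using that pos less_cSUP_iff[of UNIV G "t * b"] G(2)
        by (auto simp: less_divide_eq b_def)
      show "F u / a * (G v / b) \<le> (H ((u + v) / 2 + c) / s)\<^sup>2" for u v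
        using mid[of u v] pos s by (simp add: power_divide divide_right_mono)
    qed measurable
    note normalized = ennreal_mult_le_square_if_sum_le[OF this]
    have "(\<integral>\<^sup>+x. F x \<partial>lborel) * (\<integral>\<^sup>+x. G x \<partial>lborel) =
        ennreal (s\<^sup>2) * ((\<integral>\<^sup>+x. F x / a \<partial>lborel) * (\<integral>\<^sup>+x. G x / b \<partial>lborel))"
      using pos by (simp add: scale[of a F] scale[of b G] s ennreal_mult mult_ac)
    also have "\<dots> \<le> ennreal (s\<^sup>2) * (\<integral>\<^sup>+x. H x / s \<partial>lborel)\<^sup>2"
      by (intro mult_left_mono normalized) auto
    also have "\<dots> = (\<integral>\<^sup>+x. H x \<partial>lborel)\<^sup>2"
      using s by (simp add: scale[of s H] power_mult_distrib ennreal_power)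
    finally show ?thesis .
  qed
qed

lemma SUP_min_of_nat_ennreal: "(SUP n. min x (of_nat n)) = (x::ennreal)"
proof -
  have "(SUP n. min x (of_nat n)) = inf x (SUP n. of_nat n)"
    unfolding inf_min[symmetric] by (rule inf_SUP[symmetric])
  also have "\<dots> = x"
    by (simp add: ennreal_SUP_of_nat_eq_top)
  finally show ?thesis .
qed

text \<open>Cutting all three functions off at the same height \<open>n\<close> preserves the hypothesis, since the product
  of two values that are at most \<open>n\<close> is at most \<open>n\<^sup>2\<close>. Monotone convergence then removes the cutoff.\<close>

lemma prekopa_leindler_real:
  fixes f g h :: "real \<Rightarrow> ennreal"
  assumes [measurable]: "f \<in> borel_measurable borel" "g \<in> borel_measurable borel"
      "h \<in> borel_measurable borel"
    and mid: "\<And>u v. f u * g v \<le> (h ((u + v) / 2 + c))\<^sup>2"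
  shows "(\<integral>\<^sup>+x. f x \<partial>lborel) * (\<integral>\<^sup>+x. g x \<partial>lborel) \<le> (\<integral>\<^sup>+x. h x \<partial>lborel)\<^sup>2"
proof -
  define cut where "cut k n x = min (k x) (of_nat n)" for k :: "real \<Rightarrow> ennreal" and n x
  have cut_meas [measurable]: "cut k n \<in> borel_measurable borel"
    if [measurable]: "k \<in> borel_measurable borel" for k n
    unfolding cut_def by measurable
  have cut_fin: "ennreal (enn2real (cut k n x)) = cut k n x" for k n x
    by (rule ennreal_enn2real) (simp add: cut_def min_less_iff_disj of_nat_less_top)
  have cut_le: "enn2real (cut k n x) \<le> real n" for k n x
  proof -
    have "ennreal (enn2real (cut k n x)) \<le> ennreal (real n)"
      unfolding cut_fin by (simp add: cut_def ennreal_of_nat_eq_real_of_nat)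
    then show ?thesis by simp
  qed
  have cut_mid: "cut f n u * cut g n v \<le> (cut h n ((u + v) / 2 + c))\<^sup>2" for n u v
  proof (cases "h ((u + v) / 2 + c) \<le> of_nat n")
    case True
    have "cut f n u * cut g n v \<le> f u * g v"
      by (intro mult_mono) (auto simp: cut_def)
    with mid[of u v] True show ?thesis
      by (simp add: cut_def min_absorb1)
  next
    case False
    have "cut f n u * cut g n v \<le> of_nat n * of_nat n"
      by (intro mult_mono) (auto simp: cut_def)
    with False show ?thesis
      by (simp add: cut_def min_absorb2 power2_eq_square)
  qed
  have cut: "(\<integral>\<^sup>+x. cut f n x \<partial>lborel) * (\<integral>\<^sup>+x. cut g n x \<partial>lborel) \<le> (\<integral>\<^sup>+x. h x \<partial>lborel)\<^sup>2" for n
  proof -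
    have "(\<integral>\<^sup>+x. enn2real (cut f n x) \<partial>lborel) * (\<integral>\<^sup>+x. enn2real (cut g n x) \<partial>lborel)
      \<le> (\<integral>\<^sup>+x. enn2real (cut h n x) \<partial>lborel)\<^sup>2"
    proof (rule prekopa_leindler_bounded[where c = c])
      show "bdd_above (range (\<lambda>x. enn2real (cut f n x)))"
           "bdd_above (range (\<lambda>x. enn2real (cut g n x)))"
        using cut_le by (auto intro!: bdd_aboveI2)
      show "enn2real (cut f n u) * enn2real (cut g n v) \<le> (enn2real (cut h n ((u + v) / 2 + c)))\<^sup>2"
        for u v
      proof -
        have "ennreal (enn2real (cut f n u) * enn2real (cut g n v))
            \<le> ennreal ((enn2real (cut h n ((u + v) / 2 + c)))\<^sup>2)"
          using cut_mid[of n u v] by (simp add: ennreal_mult ennreal_power[symmetric] cut_fin)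
        then show ?thesis by simp
      qed
    qed auto
    then have "(\<integral>\<^sup>+x. cut f n x \<partial>lborel) * (\<integral>\<^sup>+x. cut g n x \<partial>lborel) \<le> (\<integral>\<^sup>+x. cut h n x \<partial>lborel)\<^sup>2"
      by (simp only: cut_fin)
    also have "\<dots> \<le> (\<integral>\<^sup>+x. h x \<partial>lborel)\<^sup>2"
      by (intro power_mono nn_integral_mono) (auto simp: cut_def)
    finally show ?thesis .
  qed
  have cut_mono: "cut k m x \<le> cut k n x" if "m \<le> n" for k m n x
    using that unfolding cut_def by (intro min.mono) auto
  have cut_SUP: "(\<integral>\<^sup>+x. k x \<partial>lborel) = (SUP n. \<integral>\<^sup>+x. cut k n x \<partial>lborel)"
    if [measurable]: "k \<in> borel_measurable borel" for k
  proof -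
    have "(\<integral>\<^sup>+x. k x \<partial>lborel) = (\<integral>\<^sup>+x. (SUP n. cut k n x) \<partial>lborel)"
      by (simp add: cut_def SUP_min_of_nat_ennreal)
    also have "\<dots> = (SUP n. \<integral>\<^sup>+x. cut k n x \<partial>lborel)"
      by (intro nn_integral_monotone_convergence_SUP) (auto simp: incseq_def le_fun_def cut_mono)
    finally show ?thesis .
  qed
  \<comment> \<open>Independent cutoff heights let the two suprema be taken one after the other.\<close>
  have "(\<integral>\<^sup>+x. cut f m x \<partial>lborel) * (\<integral>\<^sup>+x. cut g n x \<partial>lborel) \<le> (\<integral>\<^sup>+x. h x \<partial>lborel)\<^sup>2" for m n
  proof -
    have "(\<integral>\<^sup>+x. cut f m x \<partial>lborel) * (\<integral>\<^sup>+x. cut g n x \<partial>lborel)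
      \<le> (\<integral>\<^sup>+x. cut f (max m n) x \<partial>lborel) * (\<integral>\<^sup>+x. cut g (max m n) x \<partial>lborel)"
      by (intro mult_mono nn_integral_mono cut_mono) auto
    also note cut
    finally show ?thesis .
  qed
  then show ?thesis
    by (simp add: cut_SUP[of f] cut_SUP[of g] SUP_mult_left_ennreal SUP_mult_right_ennreal SUP_le_iff)
qed

section \<open>The Prekopa-Leindler inequality in finite dimension\<close>

text \<open>The inequality tensorizes: by its one-dimensional case, the marginals of \<open>f\<close>, \<open>g\<close> and \<open>h\<close> along a
  coordinate satisfy the hypothesis again, and by Fubini's theorem they have the same integrals. The
  shift \<open>c\<close> makes room for affine charts whose base points are not in midpoint position. The
  midpoint relation is required on \<open>I\<close> only, because points of the product space are fixed to
  \<open>undefined\<close> elsewhere.\<close>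

lemma prekopa_leindler_PiM:
  fixes f g h :: "('i \<Rightarrow> real) \<Rightarrow> ennreal" and c :: "'i \<Rightarrow> real"
  assumes "finite I"
    and "f \<in> borel_measurable (PiM I (\<lambda>_. lborel))" "g \<in> borel_measurable (PiM I (\<lambda>_. lborel))"
      "h \<in> borel_measurable (PiM I (\<lambda>_. lborel))"
    and "\<And>x y z. x \<in> extensional I \<Longrightarrow> y \<in> extensional I \<Longrightarrow> z \<in> extensional I \<Longrightarrow>
      (\<And>i. i \<in> I \<Longrightarrow> z i = (x i + y i) / 2 + c i) \<Longrightarrow> f x * g y \<le> (h z)\<^sup>2"
  shows "(\<integral>\<^sup>+x. f x \<partial>PiM I (\<lambda>_. lborel)) * (\<integral>\<^sup>+x. g x \<partial>PiM I (\<lambda>_. lborel))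
    \<le> (\<integral>\<^sup>+x. h x \<partial>PiM I (\<lambda>_. lborel))\<^sup>2"
  using assms
proof (induction I arbitrary: f g h rule: finite_induct)
  case empty
  have "f (\<lambda>_. undefined) * g (\<lambda>_. undefined) \<le> (h (\<lambda>_. undefined))\<^sup>2"
    using empty by auto
  then show ?case
    by (simp add: PiM_empty nn_integral_count_space_finite)
next
  case (insert i I)
  interpret product_sigma_finite "\<lambda>_::'i. lborel :: real measure"
    by unfold_locales
  note [measurable] = insert.prems(1-3)
  define marg where "marg k x = (\<integral>\<^sup>+t. k (x(i := t)) \<partial>lborel)"
    for k :: "('i \<Rightarrow> real) \<Rightarrow> ennreal" and x
  have [measurable]: "marg k \<in> borel_measurable (PiM I (\<lambda>_. lborel))"
    if [measurable]: "k \<in> borel_measurable (PiM (insert i I) (\<lambda>_. lborel))" for k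
    unfolding marg_def by measurable
  have fubini: "integral\<^sup>N (PiM (insert i I) (\<lambda>_. lborel)) k = integral\<^sup>N (PiM I (\<lambda>_. lborel)) (marg k)"
    if "k \<in> borel_measurable (PiM (insert i I) (\<lambda>_. lborel))" for k
    unfolding marg_def using that insert.hyps by (intro product_nn_integral_insert) auto
  have "integral\<^sup>N (PiM I (\<lambda>_. lborel)) (marg f) * integral\<^sup>N (PiM I (\<lambda>_. lborel)) (marg g)
      \<le> (integral\<^sup>N (PiM I (\<lambda>_. lborel)) (marg h))\<^sup>2"
  proof (rule insert.IH)
    fix x y z
    assume ext: "x \<in> extensional I" "y \<in> extensional I" "z \<in> extensional I"
      and z: "\<And>j. j \<in> I \<Longrightarrow> z j = (x j + y j) / 2 + c j"
    have [measurable]: "(\<lambda>t. w(i := t)) \<in> borel \<rightarrow>\<^sub>M PiM (insert i I) (\<lambda>_. lborel)"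
      if "w \<in> extensional I" for w :: "'i \<Rightarrow> real"
      using that
      by (intro measurable_PiM_single') (auto simp: extensional_def split: if_splits)
    show "marg f x * marg g y \<le> (marg h z)\<^sup>2"
      unfolding marg_def
    proof (rule prekopa_leindler_real[where c = "c i"])
      show "(\<lambda>t. f (x(i := t))) \<in> borel_measurable borel" "(\<lambda>t. g (y(i := t))) \<in> borel_measurable borel"
         "(\<lambda>t. h (z(i := t))) \<in> borel_measurable borel"
        using ext by measurable
      fix u v
      show "f (x(i := u)) * g (y(i := v)) \<le> (h (z(i := (u + v) / 2 + c i)))\<^sup>2"
        using ext z by (intro insert.prems(4)) (auto simp: extensional_def)
    qed
  qed measurable
  then show ?case
    by (simp add: fubini)
qed

section \<open>Lebesgue measure on the hyperplanes of constant coordinate sum\<close>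

lemma orthonormal_frame_exists:
  fixes U :: "'a::euclidean_space set"
  assumes "subspace U"
  shows "\<exists>b. orthonormal_frame b (dim U) U"
proof -
  obtain B where B: "pairwise orthogonal B" "\<And>x. x \<in> B \<Longrightarrow> norm x = 1"
      "independent B" "card B = dim U" "span B = U"
    using orthonormal_basis_subspace[OF assms] by metis
  then obtain b where b: "bij_betw b {..<dim U} B"
    using ex_bij_betw_nat_finite[of B] independent_imp_finite[of B] by (auto simp: atLeast0LessThan)
  have "b i \<bullet> b j = (if i = j then 1 else 0)" if "i < dim U" "j < dim U" for i j
  proof (cases "i = j")
    case True
    then show ?thesis
      using B(2)[of "b i"] b that by (auto simp: norm_eq_1 bij_betw_def)
  next
    case False
    then have "b i \<noteq> b j"
      using b that by (auto simp: bij_betw_def inj_on_def)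
    then have "orthogonal (b i) (b j)"
      using b that B(1) by (auto simp: bij_betw_def pairwise_def)
    with False show ?thesis
      by (simp add: orthogonal_def)
  qed
  moreover have "span (b ` {..<dim U}) = U"
    using b B(5) by (simp add: bij_betw_def)
  ultimately show ?thesis
    unfolding orthonormal_frame_def by blast
qed

lemma sum_hyperplane_eq_inner: "sum_hyperplane k = {x :: real^'n. (\<chi> i. 1) \<bullet> x = k}"
  by (simp add: sum_hyperplane_def inner_vec_def)

lemma subspace_sum_hyperplane_0: "subspace (sum_hyperplane 0 :: (real^'n) set)"
  unfolding sum_hyperplane_eq_inner by (rule subspace_hyperplane)

lemma ones_neq_0: "(\<chi> i. 1) \<noteq> (0 :: real^'n)"
  by (simp add: vec_eq_iff)

lemma aff_dim_sum_hyperplane: "aff_dim (sum_hyperplane k :: (real^'n) set) = int (CARD('n) - 1)"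
  unfolding sum_hyperplane_eq_inner using aff_dim_hyperplane[OF ones_neq_0, of k]
  by (simp add: of_nat_diff)

lemma dim_sum_hyperplane_0: "dim (sum_hyperplane 0 :: (real^'n) set) = CARD('n) - 1"
  using aff_dim_subspace[OF subspace_sum_hyperplane_0] aff_dim_sum_hyperplane[of 0]
  by (metis of_nat_eq_iff)

lemma sum_hyperplane_nonempty: "\<exists>p. p \<in> (sum_hyperplane k :: (real^'n) set)"
  by (rule exI[of _ "\<chi> i. k / real CARD('n)"]) (simp add: sum_hyperplane_def)

lemma sum_hyperplane_translate:
  fixes p :: "real^'n"
  assumes "p \<in> sum_hyperplane k"
  shows "(\<lambda>x. x - p) ` sum_hyperplane k = sum_hyperplane 0"
proof
  show "(\<lambda>x. x - p) ` sum_hyperplane k \<subseteq> sum_hyperplane 0"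
    using assms by (auto simp: sum_hyperplane_def sum_subtractf)
  show "sum_hyperplane 0 \<subseteq> (\<lambda>x. x - p) ` sum_hyperplane k"
  proof
    fix x :: "real^'n" assume "x \<in> sum_hyperplane 0"
    then have "x + p \<in> sum_hyperplane k"
      using assms by (simp add: sum_hyperplane_def sum.distrib)
    then show "x \<in> (\<lambda>x. x - p) ` sum_hyperplane k"
      by (rule rev_image_eqI) simp
  qed
qed

text \<open>The hyperplanes are parallel. The basis in the definition of the measure is chosen as a function of
  the dimension and the direction space alone, so it is the same one for all \<open>k\<close>, and just the base
  point varies. Hence the measures on different hyperplanes can be compared in the coordinates
  of \<open>\<real>\<^sup>m\<close>.\<close>

lemma affine_lebesgue_sum_hyperplane:
  obtains b :: "nat \<Rightarrow> real^'n" and p :: "real \<Rightarrow> real^'n"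
  where "orthonormal_frame b (CARD('n) - 1) (sum_hyperplane 0)"
    and "\<And>k. p k \<in> sum_hyperplane k"
    and "\<And>k. affine_lebesgue (sum_hyperplane k) =
      completion (distr (PiM {..<CARD('n) - 1} (\<lambda>_. lborel)) borel
        (\<lambda>y. p k + (\<Sum>i<CARD('n) - 1. y i *\<^sub>R b i)))"
proof -
  let ?m = "CARD('n) - 1"
  define b where "b = (SOME b. orthonormal_frame b ?m (sum_hyperplane 0 :: (real^'n) set))"
  define p where "p k = (SOME p. p \<in> (sum_hyperplane k :: (real^'n) set))" for k
  have "\<exists>b. orthonormal_frame b ?m (sum_hyperplane 0 :: (real^'n) set)"
    using orthonormal_frame_exists[OF subspace_sum_hyperplane_0]
    by (metis dim_sum_hyperplane_0)
  then have b: "orthonormal_frame b ?m (sum_hyperplane 0)"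
    unfolding b_def by (rule someI_ex)
  have p: "p k \<in> sum_hyperplane k" for k
    unfolding p_def by (rule someI_ex[OF sum_hyperplane_nonempty])
  have "affine_lebesgue (sum_hyperplane k) =
      completion (distr (PiM {..<?m} (\<lambda>_. lborel)) borel
        (\<lambda>y. p k + (\<Sum>i<?m. y i *\<^sub>R b i)))" for k
    unfolding affine_lebesgue_def Let_def p_def[symmetric] sum_hyperplane_translate[OF p]
      aff_dim_sum_hyperplane nat_int b_def[symmetric] ..
  with b p show ?thesis
    by (rule that)
qed

lemma measure_completion_distr:
  assumes "T \<in> measurable M N" "S \<in> sets N"
  shows "measure (completion (distr M N T)) S = measure M {y \<in> space M. T y \<in> S}"
proof -
  have "measure (completion (distr M N T)) S = measure (distr M N T) S"
    using assms by (simp add: measure_def)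
  also have "\<dots> = measure M {y \<in> space M. T y \<in> S}"
    using assms by (simp add: measure_distr vimage_def Int_def conj_commute)
  finally show ?thesis .
qed

lemma orthonormal_frame_coordinate:
  assumes "orthonormal_frame b m U" "i < m"
  shows "b i \<bullet> (\<Sum>j<m. y j *\<^sub>R b j) = y i"
proof -
  have "b i \<bullet> (\<Sum>j<m. y j *\<^sub>R b j) = (\<Sum>j<m. if j = i then y j else 0)"
    using assms unfolding inner_sum_right
    by (intro sum.cong) (auto simp: orthonormal_frame_def)
  also have "\<dots> = y i"
    using assms(2) by simp
  finally show ?thesis .
qed

text \<open>The inner product with a vector of the frame recovers a coordinate, so a bounded set has bounded
  coordinates and its preimage lies in a box.\<close>

lemma emeasure_frame_chart_finite:
  fixes b :: "nat \<Rightarrow> 'a::euclidean_space"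
  assumes frame: "orthonormal_frame b m U" and "bounded S"
  shows "emeasure (PiM {..<m} (\<lambda>_. lborel))
    {y \<in> space (PiM {..<m} (\<lambda>_. lborel)). p + (\<Sum>i<m. y i *\<^sub>R b i) \<in> S} < top"
    (is "emeasure ?M ?A < _")
proof -
  interpret product_sigma_finite "\<lambda>_::nat. lborel :: real measure"
    by unfold_locales
  obtain R where R: "\<And>x. x \<in> S \<Longrightarrow> norm x \<le> R"
    using assms(2) by (auto simp: bounded_iff)
  have "?A \<subseteq> (\<Pi>\<^sub>E i\<in>{..<m}. {- (R + norm p)..R + norm p})"
  proof
    fix y assume y: "y \<in> ?A"
    have "y i \<in> {- (R + norm p)..R + norm p}" if i: "i < m" for i
    proof -
      let ?x = "p + (\<Sum>i<m. y i *\<^sub>R b i)"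
      have "y i = b i \<bullet> (?x - p)"
        using orthonormal_frame_coordinate[OF frame i] by simp
      moreover have "norm (b i) = 1"
        using frame i by (simp add: orthonormal_frame_def norm_eq_1)
      ultimately have "\<bar>y i\<bar> \<le> norm (?x - p)"
        using Cauchy_Schwarz_ineq2[of "b i" "?x - p"] by simp
      also have "\<dots> \<le> norm ?x + norm p"
        by (rule norm_triangle_ineq4)
      also have "norm ?x \<le> R"
        using y R by blast
      finally show ?thesis by auto
    qed
    then show "y \<in> (\<Pi>\<^sub>E i\<in>{..<m}. {- (R + norm p)..R + norm p})"
      using y by (auto simp: space_PiM PiE_def)
  qed
  then have "emeasure ?M ?A \<le> emeasure ?M (\<Pi>\<^sub>E i\<in>{..<m}. {- (R + norm p)..R + norm p})"
    by (rule emeasure_mono) simp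
  also have "\<dots> = (\<Prod>i<m. emeasure lborel {- (R + norm p)..R + norm p})"
    by (rule emeasure_PiM) auto
  also have "\<dots> < top"
    by (simp add: power_less_top_ennreal emeasure_lborel_Icc_eq)
  finally show ?thesis .
qed

text \<open>This is the Prekopa-Leindler inequality for the indicator functions of the three sets in the
  coordinates of their charts. The shift \<open>c\<close> is the coordinate vector of \<open>(1/2) *\<^sub>R (p + q) - r\<close>. The set
  \<open>R\<close> has to be bounded since \<open>measure\<close> turns an infinite volume into 0.\<close>

lemma brunn_minkowski_parallel:
  fixes b :: "nat \<Rightarrow> 'a::euclidean_space" and m :: nat
  defines "vol p S \<equiv> measure (completion (distr (PiM {..<m} (\<lambda>_. lborel)) borel
    (\<lambda>y. p + (\<Sum>i<m. y i *\<^sub>R b i)))) S"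
  assumes frame: "orthonormal_frame b m U"
    and base: "(1/2) *\<^sub>R (p + q) - r \<in> U"
    and [measurable]: "S \<in> sets borel" "T \<in> sets borel" "R \<in> sets borel" and "bounded R"
    and mid: "\<And>x y. x \<in> S \<Longrightarrow> y \<in> T \<Longrightarrow> (1/2) *\<^sub>R (x + y) \<in> R"
  shows "vol p S * vol q T \<le> (vol r R)\<^sup>2"
proof -
  define M where "M = PiM {..<m} (\<lambda>_::nat. lborel :: real measure)"
  define chart where "chart s y = s + (\<Sum>i<m. y i *\<^sub>R b i)" for s :: 'a and y :: "nat \<Rightarrow> real"
  define pre where "pre s Q = {y \<in> space M. chart s y \<in> Q}" for s Q
  have [measurable]: "chart s \<in> borel_measurable M" for s
    unfolding chart_def M_def by measurable
  have vol: "vol s Q = measure M (pre s Q)" if "Q \<in> sets borel" for s Q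
    unfolding vol_def pre_def M_def[symmetric] chart_def[symmetric]
    using that by (intro measure_completion_distr) auto
  have [measurable]: "pre s Q \<in> sets M" if [measurable]: "Q \<in> sets borel" for s Q
    unfolding pre_def by measurable
  have "(1/2) *\<^sub>R (p + q) - r \<in> span (b ` {..<m})"
    using base frame by (simp add: orthonormal_frame_def)
  then obtain c where c: "(1/2) *\<^sub>R (p + q) - r = (\<Sum>i<m. c i *\<^sub>R b i)"
  proof -
    define w where "w = (1/2) *\<^sub>R (p + q) - r"
    have "inj_on b {..<m}"
      using frame by (auto simp: inj_on_def orthonormal_frame_def split: if_splits) (metis zero_neq_one)
    moreover obtain u where "w = (\<Sum>v\<in>b ` {..<m}. u v *\<^sub>R v)"
      using \<open>_ \<in> span (b ` {..<m})\<close> span_finite[of "b ` {..<m}"] by (auto simp: w_def)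
    ultimately have "w = (\<Sum>i<m. u (b i) *\<^sub>R b i)"
      by (simp add: sum.reindex)
    then show ?thesis
      using that[of "\<lambda>i. u (b i)"] by (simp add: w_def)
  qed
  have "(\<integral>\<^sup>+y. indicator (pre p S) y \<partial>M) * (\<integral>\<^sup>+y. indicator (pre q T) y \<partial>M)
      \<le> (\<integral>\<^sup>+y. indicator (pre r R) y \<partial>M)\<^sup>2"
    unfolding M_def
  proof (rule prekopa_leindler_PiM[where c = c], unfold M_def[symmetric])
    fix x y z :: "nat \<Rightarrow> real"
    assume ext: "z \<in> extensional {..<m}"
      and z: "\<And>i. i \<in> {..<m} \<Longrightarrow> z i = (x i + y i) / 2 + c i"
    have "(\<Sum>i<m. z i *\<^sub>R b i) = (\<Sum>i<m. (1/2) *\<^sub>R (x i *\<^sub>R b i) + (1/2) *\<^sub>R (y i *\<^sub>R b i) + c i *\<^sub>R b i)"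
      using z by (intro sum.cong) (auto simp: scaleR_add_left add_divide_distrib)
    also have "\<dots> = (1/2) *\<^sub>R (\<Sum>i<m. x i *\<^sub>R b i) + (1/2) *\<^sub>R (\<Sum>i<m. y i *\<^sub>R b i)
        + ((1/2) *\<^sub>R (p + q) - r)"
      unfolding c by (simp only: sum.distrib scaleR_sum_right)
    finally have chart_z: "chart r z = (1/2) *\<^sub>R (chart p x + chart q y)"
      by (simp add: chart_def algebra_simps)
    have "z \<in> space M"
      using ext by (simp add: M_def space_PiM PiE_def)
    then have "x \<in> pre p S \<Longrightarrow> y \<in> pre q T \<Longrightarrow> z \<in> pre r R"
      using mid by (simp add: pre_def chart_z)
    then show "indicator (pre p S) x * indicator (pre q T) y \<le> (indicator (pre r R) z :: ennreal)\<^sup>2"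
      by (auto simp: indicator_def)
  qed auto
  then have "emeasure M (pre p S) * emeasure M (pre q T) \<le> (emeasure M (pre r R))\<^sup>2"
    by simp
  moreover have "(emeasure M (pre r R))\<^sup>2 < top"
    using emeasure_frame_chart_finite[OF frame \<open>bounded R\<close>, of r]
    by (simp add: M_def pre_def chart_def power_less_top_ennreal)
  ultimately have "enn2real (emeasure M (pre p S) * emeasure M (pre q T))
      \<le> enn2real ((emeasure M (pre r R))\<^sup>2)"
    by (rule enn2real_mono)
  then show ?thesis
    by (simp add: vol measure_def enn2real_mult power2_eq_square)
qed

section \<open>Slices of the graph polytope\<close>

lemma graph_polytope_eq_inequalities:
  "graph_polytope E = {x. \<forall>i. 0 \<le> x $ i \<and> x $ i \<le> 1 \<and> 1 \<le> (adjacency_matrix E *v x) $ i + x $ i}"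
  by (auto simp: graph_polytope_def)

lemma closed_graph_polytope: "closed (graph_polytope E)"
  unfolding graph_polytope_eq_inequalities
  by (intro closed_Collect_all closed_Collect_conj closed_Collect_le continuous_intros)

lemma convex_graph_polytope: "convex (graph_polytope E)"
proof (rule convexI)
  fix x y and u v :: real
  assume xy: "x \<in> graph_polytope E" "y \<in> graph_polytope E" and uv: "0 \<le> u" "0 \<le> v" "u + v = 1"
  let ?L = "\<lambda>i x. (adjacency_matrix E *v x) $ i + x $ i"
  have "?L i (u *\<^sub>R x + v *\<^sub>R y) = u * ?L i x + v * ?L i y" for i
    by (simp add: matrix_vector_right_distrib matrix_vector_mult_scaleR algebra_simps)
  moreover have "u * 1 + v * 1 \<le> u * ?L i x + v * ?L i y" for i
    using xy uv by (intro add_mono mult_left_mono) (auto simp: graph_polytope_def)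
  ultimately have "1 \<le> ?L i (u *\<^sub>R x + v *\<^sub>R y)" for i
    using uv by simp
  moreover have "u * x $ i + v * y $ i \<le> u * 1 + v * 1" for i
    using xy uv by (intro add_mono mult_left_mono) (auto simp: graph_polytope_def)
  ultimately show "u *\<^sub>R x + v *\<^sub>R y \<in> graph_polytope E"
    using xy uv by (auto simp: graph_polytope_def)
qed

lemma bounded_graph_polytope: "bounded (graph_polytope E)"
proof -
  have "graph_polytope E \<subseteq> cbox 0 1"
    by (auto simp: graph_polytope_def mem_box_cart)
  then show ?thesis
    using bounded_cbox bounded_subset by blast
qed

lemma closed_graph_slice: "closed (graph_slice E k)"
  unfolding graph_slice_def sum_hyperplane_eq_inner
  by (intro closed_Int closed_graph_polytope closed_hyperplane)

theorem theorem3p2: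
  fixes E :: "'n::finite set set" and k :: nat
  assumes "undirected_graph E" and "1 \<le> k" and "k \<le> CARD('n) - 1"
  shows "(slice_volume E (real k))\<^sup>2 \<ge> slice_volume E (real k - 1) * slice_volume E (real k + 1)"
proof -
  obtain b :: "nat \<Rightarrow> real^'n" and p :: "real \<Rightarrow> real^'n"
    where frame: "orthonormal_frame b (CARD('n) - 1) (sum_hyperplane 0)"
      and p: "\<And>t. p t \<in> sum_hyperplane t"
      and lebesgue: "\<And>t. affine_lebesgue (sum_hyperplane t) =
        completion (distr (PiM {..<CARD('n) - 1} (\<lambda>_. lborel)) borel
          (\<lambda>y. p t + (\<Sum>i<CARD('n) - 1. y i *\<^sub>R b i)))"
    using affine_lebesgue_sum_hyperplane by blast
  show ?thesis
    unfolding slice_volume_def lebesgue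
  proof (rule brunn_minkowski_parallel[OF frame])
    show "(1/2) *\<^sub>R (p (real k - 1) + p (real k + 1)) - p (real k) \<in> sum_hyperplane 0"
      using p[of "real k - 1"] p[of "real k + 1"] p[of "real k"]
      by (simp add: sum_hyperplane_def sum_subtractf sum.distrib flip: sum_divide_distrib)
    show "bounded (graph_slice E (real k))"
      using bounded_graph_polytope bounded_subset unfolding graph_slice_def by blast
    fix x y
    assume xy: "x \<in> graph_slice E (real k - 1)" "y \<in> graph_slice E (real k + 1)"
    then have "(1/2) *\<^sub>R x + (1/2) *\<^sub>R y \<in> graph_polytope E"
      by (intro convexD[OF convex_graph_polytope]) (auto simp: graph_slice_def)
    moreover have "(1/2) *\<^sub>R (x + y) \<in> sum_hyperplane (real k)"
      using xy
      by (simp add: graph_slice_def sum_hyperplane_def sum.distrib flip: sum_divide_distrib)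
    ultimately show "(1/2) *\<^sub>R (x + y) \<in> graph_slice E (real k)"
      by (simp add: graph_slice_def scaleR_add_right)
  qed (auto intro: borel_closed closed_graph_slice)
qed

end
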